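(* Let $\mathbf P=(P,+,\bar{}\,,\tilde{}\,,0,1)$ be a good monotonous pseudoeffect algebra with induced order $\leq$. Let $\mathbb R(\mathbf P)=(P,\leq,\odot,\rightarrow,\leadsto,\bar{}\,,\tilde{}\,,0,1)$ where $x\odot y:=\widetilde{\bar x+\bar y}$ (defined iff $\tilde x\leq y$), $x\rightarrow y:=\{\bar x+u\mid u\in L(x,y)\}$ and $x\leadsto y:=\{u+\tilde x\mid u\in L(x,y)\}$, and let $\mathbb P(\mathbb R(\mathbf P))=(P,\oplus,\bar{}\,,\tilde{}\,,0,1)$ where $x\oplus y:=\widetilde{\bar x\odot\bar y}$, defined if and only if $x\leq\bar y$. Then $\mathbb P(\mathbb R(\mathbf P))=\mathbf P$, i.e. for all $a,b\in P$, $a\oplus b$ is defined iff $a+b$ is defined, and in this case $a\oplus b=a+b$.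
   Context: A pseudoeffect algebra is a partial algebra $(P,+,\bar{}\,,\tilde{}\,,0,1)$ of type $(2,1,1,0,0)$ where $(P,\bar{}\,,\tilde{}\,,0,1)$ is an algebra and $+$ is a partial binary operation such that for all $x,y,z\in P$: (P1) if $x+y$ is defined then there exist $u,w\in P$ with $u+x=y+w=x+y$; (P2) $(x+y)+z$ is defined iff $x+(y+z)$ is defined, and then they are equal; (P3) $\bar x$ is the unique $u$ with $u+x=1$ and $\tilde x$ is the unique $w$ with $x+w=1$; (P4) if $1+x$ or $x+1$ is defined then $x=0$. The induced order is $x\leq y$ iff there is $z$ with $x+z=y$. We write $\widetilde{t}$ and $\overline{t}$ for the unary operations applied to a term $t$. For $A\subseteq P$: $L(A)=\{x\mid x\leq y\ \forall y\in A\}$, $U(A)=\{x\mid y\leq x\ \forall y\in A\}$, $L(a,b)=L(\{a,b\})$. For subsets $A,B$, $A\leq B$ means $x\leq y$ for all $x\in A,y\in B$; $x+A=\{x+y\mid y\in A\}$, $A+x=\{y+x\mid y\in A\}$. $\mathbf P$ is good if $\widetilde{\bar x+\bar y}=\overline{\tilde x+\tilde y}$ for all $x,y\in P$ with $\tilde x\leq y$. $\mathbf P$ is monotonous if for all $x\in P$ and non-empty $A,B\subseteq P$: $A\cup B\leq\bar x$ and $L(A)\leq U(B)$ imply $L(A+x)\leq U(B+x)$; and $A\cup B\leq\tilde x$ and $L(A)\leq U(B)$ imply $L(x+A)\leq U(x+B)$. *)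

theory Defs
  imports Main
begin

text \<open>
  The universe of every structure is the whole type \<open>'a\<close>.  A partial binary operation is a
  function into \<open>'a option\<close>, where \<open>None\<close> stands for ``undefined''.  The unary
  operations written as a bar and as a tilde in the literature are \<open>bar\<close> and \<open>tilde\<close>.
\<close>

record 'a peff =
  padd :: "'a \<Rightarrow> 'a \<Rightarrow> 'a option"
  bar :: "'a \<Rightarrow> 'a"
  tilde :: "'a \<Rightarrow> 'a"
  pzero :: 'a
  pone :: 'a

text \<open>
  In \<open>P2\<close>, equality of the two options says that one side is defined iff the other one is, and
  that the values then coincide.
\<close>

locale pseudoeffect_algebra =
  fixes P :: "'a peff"
  assumes P1: "padd P x y = Some s \<Longrightarrow> \<exists>u w. padd P u x = Some s \<and> padd P y w = Some s"
    and P2: "Option.bind (padd P x y) (\<lambda>s. padd P s z) =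
             Option.bind (padd P y z) (\<lambda>t. padd P x t)"
    and P3_bar: "padd P u x = Some (pone P) \<longleftrightarrow> u = bar P x"
    and P3_tilde: "padd P x w = Some (pone P) \<longleftrightarrow> w = tilde P x"
    and P4: "padd P (pone P) x \<noteq> None \<or> padd P x (pone P) \<noteq> None \<Longrightarrow> x = pzero P"

definition le :: "'a peff \<Rightarrow> 'a \<Rightarrow> 'a \<Rightarrow> bool" where
  "le P x y \<longleftrightarrow> (\<exists>z. padd P x z = Some y)"

definition Lower :: "'a peff \<Rightarrow> 'a set \<Rightarrow> 'a set" where
  "Lower P A = {x. \<forall>y\<in>A. le P x y}"

definition Upper :: "'a peff \<Rightarrow> 'a set \<Rightarrow> 'a set" where
  "Upper P A = {x. \<forall>y\<in>A. le P y x}"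

definition set_le :: "'a peff \<Rightarrow> 'a set \<Rightarrow> 'a set \<Rightarrow> bool" where
  "set_le P A B \<longleftrightarrow> (\<forall>x\<in>A. \<forall>y\<in>B. le P x y)"

text \<open>
  The sets \<open>x + A\<close> and \<open>A + x\<close>.  Wherever they are used below, all the sums that
  occur in them are defined in a pseudoeffect algebra.
\<close>

definition elem_plus_set :: "'a peff \<Rightarrow> 'a \<Rightarrow> 'a set \<Rightarrow> 'a set" where
  "elem_plus_set P x A = {z. \<exists>y\<in>A. padd P x y = Some z}"

definition set_plus_elem :: "'a peff \<Rightarrow> 'a set \<Rightarrow> 'a \<Rightarrow> 'a set" where
  "set_plus_elem P A x = {z. \<exists>y\<in>A. padd P y x = Some z}"

definition good :: "'a peff \<Rightarrow> bool" where
  "good P \<longleftrightarrow> (\<forall>x y. le P (tilde P x) y \<longrightarrow>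
     map_option (tilde P) (padd P (bar P x) (bar P y)) =
     map_option (bar P) (padd P (tilde P x) (tilde P y)))"

definition monotonous :: "'a peff \<Rightarrow> bool" where
  "monotonous P \<longleftrightarrow> (\<forall>x A B. A \<noteq> {} \<longrightarrow> B \<noteq> {} \<longrightarrow>
     (set_le P (A \<union> B) {bar P x} \<longrightarrow> set_le P (Lower P A) (Upper P B) \<longrightarrow>
        set_le P (Lower P (set_plus_elem P A x)) (Upper P (set_plus_elem P B x))) \<and>
     (set_le P (A \<union> B) {tilde P x} \<longrightarrow> set_le P (Lower P A) (Upper P B) \<longrightarrow>
        set_le P (Lower P (elem_plus_set P x A)) (Upper P (elem_plus_set P x B))))"

text \<open>
  The signature of \<open>(P, \<le>, \<odot>, \<rightarrow>, \<leadsto>, bar, tilde, 0, 1)\<close>: the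
  multiplication is partial and both implications are set-valued.
\<close>

record 'a residuated =
  rle :: "'a \<Rightarrow> 'a \<Rightarrow> bool"
  rmult :: "'a \<Rightarrow> 'a \<Rightarrow> 'a option"
  rimp :: "'a \<Rightarrow> 'a \<Rightarrow> 'a set"
  rleadsto :: "'a \<Rightarrow> 'a \<Rightarrow> 'a set"
  rbar :: "'a \<Rightarrow> 'a"
  rtilde :: "'a \<Rightarrow> 'a"
  rzero :: 'a
  rone :: 'a

text \<open>
  For a pseudoeffect algebra, the sum under \<open>map_option\<close> is defined whenever the guard of the
  conditional holds, so the guard is exactly the domain of the operation; likewise for
  \<open>peff_of\<close> below, applied to \<open>residuated_of P\<close>.
\<close>

definition residuated_of :: "'a peff \<Rightarrow> 'a residuated" where
  "residuated_of P = \<lparr>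
     rle = le P,
     rmult = (\<lambda>x y. if le P (tilde P x) y
                     then map_option (tilde P) (padd P (bar P x) (bar P y)) else None),
     rimp = (\<lambda>x y. elem_plus_set P (bar P x) (Lower P {x, y})),
     rleadsto = (\<lambda>x y. set_plus_elem P (Lower P {x, y}) (tilde P x)),
     rbar = bar P,
     rtilde = tilde P,
     rzero = pzero P,
     rone = pone P \<rparr>"

definition peff_of :: "'a residuated \<Rightarrow> 'a peff" where
  "peff_of R = \<lparr>
     padd = (\<lambda>x y. if rle R x (rbar R y)
                    then map_option (rtilde R) (rmult R (rbar R x) (rbar R y)) else None),
     bar = rbar R,
     tilde = rtilde R,
     pzero = rzero R,
     pone = rone R \<rparr>"

end

theory Submission
  imports Defs
begin

text \<open>
  By goodness, the inner double negation of \<open>a \<oplus> b\<close> is the bar of \<open>a + b\<close>, so the two unary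
  operations, being inverse to each other, cancel. The domains agree because \<open>a + b\<close> is defined
  iff \<open>a\<close> lies below the bar of \<open>b\<close>: complete \<open>a + b\<close> to \<open>1\<close> on the left and reassociate.
\<close>

context pseudoeffect_algebra
begin

text \<open>The one equation \<open>bar P x + x = 1\<close> defines both complements.\<close>

lemma tilde_bar: "tilde P (bar P x) = x"
  using P3_bar[of "bar P x" x] P3_tilde[of "bar P x" x] by simp

lemma padd_defined_iff: "padd P a b \<noteq> None \<longleftrightarrow> le P a (bar P b)"
proof
  assume "padd P a b \<noteq> None"
  then obtain s where s: "padd P a b = Some s"
    by auto
  have "padd P (bar P s) s = Some (pone P)"
    using P3_bar by blast
  with s have "Option.bind (padd P (bar P s) a) (\<lambda>t. padd P t b) = Some (pone P)"
    by (simp add: P2)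
  \<comment> \<open>The sum is a left complement of \<open>b\<close>, hence unique.\<close>
  then have "padd P (bar P s) a = Some (bar P b)"
    by (auto simp: bind_eq_Some_conv P3_bar)
  \<comment> \<open>\<open>P1\<close> trades the left summand \<open>bar P s\<close> for a right
    one, as \<open>le\<close> requires.\<close>
  then show "le P a (bar P b)"
    unfolding le_def using P1 by blast
next
  assume "le P a (bar P b)"
  then obtain u where u: "padd P u a = Some (bar P b)"
    unfolding le_def using P1 by blast
  have "padd P (bar P b) b = Some (pone P)"
    using P3_bar by blast
  with u have "Option.bind (padd P a b) (\<lambda>t. padd P u t) = Some (pone P)"
    by (simp flip: P2)
  then show "padd P a b \<noteq> None"
    by (auto simp: bind_eq_Some_conv)
qed

lemma padd_peff_of_residuated_of:
  assumes "good P"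
  shows "padd (peff_of (residuated_of P)) a b = padd P a b"
proof (cases "le P a (bar P b)")
  case True
  \<comment> \<open>Goodness at \<open>bar P a\<close> and \<open>bar P b\<close>: by
    \<open>tilde_bar\<close> its guard is the case assumption.\<close>
  with assms have "map_option (tilde P) (padd P (bar P (bar P a)) (bar P (bar P b))) =
      map_option (bar P) (padd P a b)"
    unfolding good_def by (metis tilde_bar)
  with True show ?thesis
    by (simp add: peff_of_def residuated_of_def tilde_bar option.map_comp comp_def
        option.map_ident)
next
  case False
  then show ?thesis
    using padd_defined_iff[of a b] by (simp add: peff_of_def residuated_of_def)
qed

end

theorem theorem6:
  fixes P :: "'a peff"
  assumes "pseudoeffect_algebra P"
    and "good P"
    and "monotonous P"
  shows "peff_of (residuated_of P) = P \<and>
    (\<forall>a b. (padd (peff_of (residuated_of P)) a b \<noteq> None \<longleftrightarrow> padd P a b \<noteq> None) \<and>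
           (padd P a b \<noteq> None \<longrightarrow>
              the (padd (peff_of (residuated_of P)) a b) = the (padd P a b)))"
proof -
  have "padd (peff_of (residuated_of P)) = padd P"
    using pseudoeffect_algebra.padd_peff_of_residuated_of[OF assms(1,2)] by blast
  \<comment> \<open>All other fields pass through both constructions unchanged.\<close>
  then have "peff_of (residuated_of P) = P"
    by (intro peff.equality) (simp_all add: peff_of_def residuated_of_def)
  then show ?thesis
    by simp
qed

end
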